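(* Let $\Omega\subset\mathbb{C}$ be an open simply connected set and let $H(\Omega)$ be the space of holomorphic functions on $\Omega$ endowed with the topology of uniform convergence on compacta. Then Dirichlet polynomials are dense in $H(\Omega)$.
   Context: A Dirichlet polynomial is a function of the form $P(s)=\sum_{n=1}^{N}a_n\frac{1}{n^s}$ with $N\in\mathbb{N}$ and $a_n\in\mathbb{C}$. *)

theory Defs
  imports "HOL-Complex_Analysis.Complex_Analysis"
begin

definition dirichlet_polynomials :: "(complex \<Rightarrow> complex) set" where
  "dirichlet_polynomials =
     {P. \<exists>(N::nat) (a::nat \<Rightarrow> complex). P = (\<lambda>s. \<Sum>n=1..N. a n * (1 / (of_nat n powr s)))}"

(* HOL functions are total, so a function on \<Omega> is represented by the unique total function
   that agrees with it on \<Omega> and is undefined outside of \<Omega>. *)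
definition holomorphic_functions :: "complex set \<Rightarrow> (complex \<Rightarrow> complex) set" where
  "holomorphic_functions \<Omega> = {f \<in> extensional \<Omega>. f holomorphic_on \<Omega>}"

(* The sets of all g with |f - g| < e on K, for K a compact subset of \<Omega> and e > 0, form a
   neighbourhood base at f; finitely many of them contain a common one, obtained from the
   union of the compact sets and the minimum of the radii. *)
definition holomorphic_topology :: "complex set \<Rightarrow> (complex \<Rightarrow> complex) topology" where
  "holomorphic_topology \<Omega> = topology (\<lambda>U. U \<subseteq> holomorphic_functions \<Omega> \<and>
     (\<forall>f\<in>U. \<exists>K e. compact K \<and> K \<subseteq> \<Omega> \<and> e > 0 \<and>
        {g \<in> holomorphic_functions \<Omega>. \<forall>z\<in>K. dist (f z) (g z) < e} \<subseteq> U))"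

lemma openin_holomorphic_topology:
  "openin (holomorphic_topology \<Omega>) U \<longleftrightarrow> U \<subseteq> holomorphic_functions \<Omega> \<and>
     (\<forall>f\<in>U. \<exists>K e. compact K \<and> K \<subseteq> \<Omega> \<and> e > 0 \<and>
        {g \<in> holomorphic_functions \<Omega>. \<forall>z\<in>K. dist (f z) (g z) < e} \<subseteq> U)"
proof -
  let ?B = "\<lambda>f K e. {g \<in> holomorphic_functions \<Omega>. \<forall>z\<in>K. dist (f z) (g z) < (e::real)}"
  let ?P = "\<lambda>U. U \<subseteq> holomorphic_functions \<Omega> \<and>
     (\<forall>f\<in>U. \<exists>K e. compact K \<and> K \<subseteq> \<Omega> \<and> e > 0 \<and> ?B f K e \<subseteq> U)"
  have Int: "?P (S \<inter> T)" if S: "?P S" and T: "?P T" for S T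
  proof (intro conjI ballI)
    show "S \<inter> T \<subseteq> holomorphic_functions \<Omega>" using S by blast
    fix f assume f: "f \<in> S \<inter> T"
    obtain K d where 1: "compact K" "K \<subseteq> \<Omega>" "d > 0" "?B f K d \<subseteq> S"
      using S f by blast
    obtain L e where 2: "compact L" "L \<subseteq> \<Omega>" "e > 0" "?B f L e \<subseteq> T"
      using T f by blast
    have "?B f (K \<union> L) (min d e) \<subseteq> ?B f K d" "?B f (K \<union> L) (min d e) \<subseteq> ?B f L e"
      by auto
    then have "?B f (K \<union> L) (min d e) \<subseteq> S \<inter> T"
      by (intro Int_greatest) (erule subset_trans[OF _ 1(4)], erule subset_trans[OF _ 2(4)])
    moreover have "compact (K \<union> L)" "K \<union> L \<subseteq> \<Omega>" "min d e > 0"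
      using 1(1-3) 2(1-3) by (simp_all add: compact_Un)
    ultimately show "\<exists>K e. compact K \<and> K \<subseteq> \<Omega> \<and> e > 0 \<and> ?B f K e \<subseteq> S \<inter> T"
      by (intro exI[of _ "K \<union> L"] exI[of _ "min d e"] conjI)
  qed
  have Union: "?P (\<Union>\<U>)" if \<U>: "\<forall>U\<in>\<U>. ?P U" for \<U>
  proof (intro conjI ballI)
    show "\<Union>\<U> \<subseteq> holomorphic_functions \<Omega>" using \<U> by blast
    fix f assume "f \<in> \<Union>\<U>"
    then obtain U where U: "U \<in> \<U>" "f \<in> U" by blast
    from \<U> U(1) have "?P U" by (rule bspec)
    then obtain K e where K: "compact K" "K \<subseteq> \<Omega>" "e > 0" "?B f K e \<subseteq> U"
      using U(2) by blast
    have "?B f K e \<subseteq> \<Union>\<U>"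
      using K(4) Union_upper[OF U(1)] by (rule subset_trans)
    with K(1-3) show "\<exists>K e. compact K \<and> K \<subseteq> \<Omega> \<and> e > 0 \<and> ?B f K e \<subseteq> \<Union>\<U>"
      by (intro exI[of _ K] exI[of _ e] conjI)
  qed
  have "istopology ?P"
    unfolding istopology_def by (rule conjI; intro allI impI; (rule Int | rule Union); assumption)
  then show ?thesis
    unfolding holomorphic_topology_def by (simp add: topology_inverse')
qed

lemma topspace_holomorphic_topology [simp]:
  "topspace (holomorphic_topology \<Omega>) = holomorphic_functions \<Omega>"
proof -
  have "openin (holomorphic_topology \<Omega>) (holomorphic_functions \<Omega>)"
    unfolding openin_holomorphic_topology
    by (intro conjI ballI exI[of _ "{}"] exI[of _ "1::real"]) auto
  moreover have "topspace (holomorphic_topology \<Omega>) \<subseteq> holomorphic_functions \<Omega>"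
    using openin_topspace openin_holomorphic_topology by metis
  ultimately show ?thesis
    using openin_subset by (intro subset_antisym)
qed

lemma restrict_dirichlet_polynomial_in_holomorphic_functions:
  assumes "P \<in> dirichlet_polynomials"
  shows "restrict P \<Omega> \<in> holomorphic_functions \<Omega>"
proof -
  obtain N a where P: "P = (\<lambda>s. \<Sum>n=1..N::nat. a n * (1 / (of_nat n powr s)))"
    using assms unfolding dirichlet_polynomials_def by blast
  have "P holomorphic_on \<Omega>"
    unfolding P by (intro holomorphic_intros) (auto simp: complex_nonpos_Reals_iff)
  then have "restrict P \<Omega> holomorphic_on \<Omega>"
    by (rule holomorphic_transform) simp
  then show ?thesis
    by (simp add: holomorphic_functions_def)
qed

end

theory Submission
  imports Defs "HOL-Real_Asymp.Real_Asymp"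
begin

text \<open>
Dirichlet polynomials form an algebra, because $n^{-s} m^{-s} = (nm)^{-s}$. So do their uniform
limits on a fixed compact set. The proof therefore splits in two: show that the single function
$s$ is such a limit, which makes every polynomial one, and then show that polynomials suffice
to approximate holomorphic functions on a simply connected set (Runge's theorem).

The function $s$. One has $-s = g'(0)$ for the entire function $g(z) = e^{-zs}$, and the values of
$g$ at the nodes $\log n$ are the Dirichlet monomials $n^{-s}$. Interpolating $g$ at
$\log 1, \dots, \log N$, with $\log 1 = 0$ as a double node, thus expresses $-s$ by a Dirichlet polynomial up to an interpolation
error. Measured on the disc of radius $N$, the error is at most
$(4 e^R \log N / N)^N$ uniformly for $|s| \le R$, and this tends to $0$: the nodes grow so slowly
that the factors $\log n$ from the node polynomial are beaten by the factors $1/N$ gained from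
each division by $z - \log n$, even against the growth $e^{RN}$ of $g$ itself. This is
\<open>dirichlet_approximates_identity\<close>, based on \<open>interpolation_error\<close>.

Runge's theorem. The Riemann map gives a compact set $L \supseteq K$ in \<open>\<Omega>\<close> that is the image of a
closed disc under an injective holomorphic map, so that the complement of $L$ is connected. Cauchy's
formula on the image of a slightly larger circle represents $f$ on $L$ as an integral of functions
$c/(w - z)$ with $w \notin L$. A uniformly closed algebra that contains the identity contains
all functions $1/(w-z)$ with $w$ outside $L$ (\<open>simple_pole\<close>: start far away with a geometric series,
then move the pole through the connected complement), and it is closed under such integrals
(\<open>parametric_integral\<close>). So it contains $f$ (\<open>holomorphic_on_disc_image\<close>).
\<close>

section \<open>Interpolation of entire functions\<close>

text \<open>The divided difference of an entire function at $a$ is entire. On the circle of radius $\rho$ the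
denominator is at least $\rho/2$ and the numerator at most $2M$, and the maximum principle carries
the resulting bound into the disc.\<close>

lemma divided_difference:
  fixes g :: "complex \<Rightarrow> complex"
  assumes g: "g holomorphic_on UNIV" and a: "norm a \<le> \<rho> / 2" and "\<rho> > 0"
    and M: "\<And>z. norm z \<le> \<rho> \<Longrightarrow> norm (g z) \<le> M"
  obtains h where "h holomorphic_on UNIV" "\<And>z. g z - g a = (z - a) * h z" "h a = deriv g a"
    "\<And>z. norm z \<le> \<rho> \<Longrightarrow> norm (h z) \<le> M * (4 / \<rho>)"
proof
  define h where "h = (\<lambda>z. if z = a then deriv g a else (g z - g a) / (z - a))"
  show h: "h holomorphic_on UNIV"
    unfolding h_def using g by (rule pole_lemma) simp
  show "g z - g a = (z - a) * h z" for z
    by (simp add: h_def)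
  show "h a = deriv g a"
    by (simp add: h_def)
  show "norm (h z) \<le> M * (4 / \<rho>)" if "norm z \<le> \<rho>" for z
  proof (rule maximum_modulus_frontier[of h "cball 0 \<rho>"])
    show "h holomorphic_on interior (cball 0 \<rho>)"
      using h holomorphic_on_subset by blast
    show "continuous_on (closure (cball 0 \<rho>)) h"
      using h holomorphic_on_imp_continuous_on continuous_on_subset by blast
    fix w assume "w \<in> frontier (cball (0::complex) \<rho>)"
    then have w: "norm w = \<rho>"
      using \<open>\<rho> > 0\<close> by (simp add: frontier_cball)
    have "norm (w - a) \<ge> \<rho> / 2"
      using norm_triangle_ineq2[of w a] w a by simp
    moreover have "norm (g w - g a) \<le> 2 * M"
      using norm_triangle_ineq4[of "g w" "g a"] M[of w] M[of a] w a \<open>\<rho> > 0\<close> by simp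
    moreover have "w \<noteq> a"
      using w a \<open>\<rho> > 0\<close> by auto
    ultimately have "norm (h w) \<le> (2 * M) / (\<rho> / 2)"
      using \<open>\<rho> > 0\<close> frac_le[of "2 * M" "norm (g w - g a)" "\<rho> / 2" "norm (w - a)"]
        order_trans[OF norm_ge_zero M[of a]] a by (simp add: h_def norm_divide)
    then show "norm (h w) \<le> M * (4 / \<rho>)"
      by (simp add: field_simps)
  qed (use that in auto)
qed

text \<open>Evaluation at a point $w$ is approximated by a combination of evaluations at the nodes whose
coefficients $c$ depend on the nodes and $w$ only, not on $g$; this independence is what later lets
one set of coefficients serve all parameters $s$ at once. Adding a node $a$ amounts to applying the
estimate for the other nodes to the divided difference of $g$ at $a$ and multiplying by $w - a$: each node
contributes a factor $4/\rho$ from the division and a factor $|w - a|$ from the multiplication.\<close>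

lemma interpolation_error:
  fixes x :: "'i \<Rightarrow> complex"
  assumes "finite I" and "inj_on x I" and "\<And>i. i \<in> I \<Longrightarrow> norm (x i) \<le> \<rho> / 2"
    and "\<rho> > 0" and "norm w \<le> \<rho>"
  shows "\<exists>c. \<forall>g M. g holomorphic_on UNIV \<longrightarrow> (\<forall>z. norm z \<le> \<rho> \<longrightarrow> norm (g z) \<le> M) \<longrightarrow>
    norm (g w - (\<Sum>i\<in>I. c i * g (x i))) \<le> M * (4 / \<rho>) ^ card I * (\<Prod>i\<in>I. norm (w - x i))"
  using assms(1-3)
proof (induction I)
  case empty
  then show ?case using \<open>norm w \<le> \<rho>\<close> by auto
next
  case (insert j I)
  have "inj_on x I" "\<And>i. i \<in> I \<Longrightarrow> norm (x i) \<le> \<rho> / 2"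
    using insert.prems by (auto simp: inj_on_insert)
  with insert.IH obtain c where c: "\<And>g M. g holomorphic_on UNIV \<Longrightarrow> (\<And>z. norm z \<le> \<rho> \<Longrightarrow> norm (g z) \<le> M) \<Longrightarrow>
    norm (g w - (\<Sum>i\<in>I. c i * g (x i))) \<le> M * (4 / \<rho>) ^ card I * (\<Prod>i\<in>I. norm (w - x i))"
    by blast
  \<comment> \<open>Coefficients of $(w - a) \sum_i c_i h(x_i)$ with $a = x_j$, where
    $h(x_i) = (g(x_i) - g(a)) / (x_i - a)$.\<close>
  define b where "b = (\<lambda>i. (w - x j) * c i / (x i - x j))"
  define c' where "c' = (\<lambda>i. if i = j then 1 - (\<Sum>i\<in>I. b i) else b i)"
  show ?case
  proof (rule exI[of _ c'], intro allI impI)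
    fix g M
    assume g: "g holomorphic_on UNIV" and M: "\<forall>z. norm z \<le> \<rho> \<longrightarrow> norm (g z) \<le> M"
    have j: "norm (x j) \<le> \<rho> / 2"
      using insert.prems by simp
    obtain h where h: "h holomorphic_on UNIV" "\<And>z. g z - g (x j) = (z - x j) * h z" "h (x j) = deriv g (x j)"
      "\<And>z. norm z \<le> \<rho> \<Longrightarrow> norm (h z) \<le> M * (4 / \<rho>)"
      using divided_difference[OF g j \<open>\<rho> > 0\<close>, of M] M by auto
    have ne: "x i \<noteq> x j" if "i \<in> I" for i
      using insert.prems(1) insert.hyps that by (auto simp: inj_on_def)
    have "(\<Sum>i\<in>insert j I. c' i * g (x i)) = (1 - (\<Sum>i\<in>I. b i)) * g (x j) + (\<Sum>i\<in>I. b i * g (x i))"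
      using insert.hyps by (auto simp: c'_def intro!: sum.cong)
    also have "\<dots> = g (x j) + (\<Sum>i\<in>I. b i * (g (x i) - g (x j)))"
      by (simp add: algebra_simps sum_subtractf sum_distrib_right)
    also have "(\<Sum>i\<in>I. b i * (g (x i) - g (x j))) = (w - x j) * (\<Sum>i\<in>I. c i * h (x i))"
      unfolding sum_distrib_left by (rule sum.cong) (use ne in \<open>auto simp: h(2) b_def\<close>)
    finally have "g w - (\<Sum>i\<in>insert j I. c' i * g (x i)) = (w - x j) * (h w - (\<Sum>i\<in>I. c i * h (x i)))"
      using h(2)[of w] by (simp add: algebra_simps)
    then have "norm (g w - (\<Sum>i\<in>insert j I. c' i * g (x i))) \<le>
        norm (w - x j) * (M * (4 / \<rho>) * (4 / \<rho>) ^ card I * (\<Prod>i\<in>I. norm (w - x i)))"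
      using mult_left_mono[OF c[OF h(1,4)] norm_ge_zero[of "w - x j"]] by (simp only: norm_mult)
    then show "norm (g w - (\<Sum>i\<in>insert j I. c' i * g (x i)))
        \<le> M * (4 / \<rho>) ^ card (insert j I) * (\<Prod>i\<in>insert j I. norm (w - x i))"
      using insert.hyps by (simp add: mult_ac)
  qed
qed

section \<open>The algebra of Dirichlet polynomials\<close>

lemma dirichlet_term:
  assumes "n \<ge> 1"
  shows "(\<lambda>s. c * (1 / (of_nat n powr s))) \<in> dirichlet_polynomials"
proof -
  have "(\<Sum>k=1..n. (if k = n then c else 0) * (1 / (of_nat k powr s))) = c * (1 / (of_nat n powr s))" for s :: complex
    using assms by (subst sum.remove[of _ n]) auto
  then show ?thesis
    unfolding dirichlet_polynomials_def by (intro CollectI exI[of _ n] exI[of _ "\<lambda>k. if k = n then c else 0"]) auto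
qed

lemma dirichlet_add:
  assumes "P \<in> dirichlet_polynomials" "Q \<in> dirichlet_polynomials"
  shows "(\<lambda>s. P s + Q s) \<in> dirichlet_polynomials"
proof -
  obtain N a where P: "P = (\<lambda>s. \<Sum>n=1..N::nat. a n * (1 / (of_nat n powr s)))"
    using assms unfolding dirichlet_polynomials_def by blast
  obtain N' b where Q: "Q = (\<lambda>s. \<Sum>n=1..N'::nat. b n * (1 / (of_nat n powr s)))"
    using assms unfolding dirichlet_polynomials_def by blast
  \<comment> \<open>Pad the shorter of the two sums with zero coefficients.\<close>
  have pad: "(\<Sum>n=1..N. a n * f n) = (\<Sum>n=1..max N L. (if n \<le> N then a n else 0) * f n)"
    for N L :: nat and a f :: "nat \<Rightarrow> complex"
    by (rule sum.mono_neutral_cong_left) auto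
  define c where "c = (\<lambda>n. (if n \<le> N then a n else 0) + (if n \<le> N' then b n else 0))"
  have "P s + Q s = (\<Sum>n=1..max N N'. c n * (1 / (of_nat n powr s)))" for s
    unfolding P Q c_def pad[where N = N and L = N'] pad[where N = N' and L = N] max.commute[of N' N] distrib_right sum.distrib ..
  then show ?thesis
    unfolding dirichlet_polynomials_def by blast
qed

text \<open>In particular any linear combination of terms $n^{-s}$ with arbitrary, possibly repeated or
unordered indices is a Dirichlet polynomial, which is the form in which products appear.\<close>

lemma dirichlet_sum:
  assumes "\<And>i. i \<in> I \<Longrightarrow> P i \<in> dirichlet_polynomials"
  shows "(\<lambda>s. \<Sum>i\<in>I. P i s) \<in> dirichlet_polynomials"
proof -
  have 0: "(\<lambda>s. 0) \<in> dirichlet_polynomials"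
    using dirichlet_term[of 1 0] by simp
  show ?thesis
    using assms
  proof (induction I rule: infinite_finite_induct)
    case (insert i I)
    then show ?case
      using dirichlet_add[of "P i" "\<lambda>s. \<Sum>i\<in>I. P i s"] by simp
  qed (simp_all add: 0)
qed

lemma dirichlet_mult:
  assumes "P \<in> dirichlet_polynomials" "Q \<in> dirichlet_polynomials"
  shows "(\<lambda>s. P s * Q s) \<in> dirichlet_polynomials"
proof -
  obtain N a where P: "P = (\<lambda>s. \<Sum>n=1..N::nat. a n * (1 / (of_nat n powr s)))"
    using assms unfolding dirichlet_polynomials_def by blast
  obtain N' b where Q: "Q = (\<lambda>s. \<Sum>n=1..N'::nat. b n * (1 / (of_nat n powr s)))"
    using assms unfolding dirichlet_polynomials_def by blast
  have mult: "of_nat (n * m) powr s = of_nat n powr s * of_nat m powr s"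
    if "n \<ge> 1" "m \<ge> 1" for n m :: nat and s :: complex
    using that by (simp add: powr_times_real)
  have "P s * Q s = (\<Sum>n=1..N. \<Sum>m=1..N'. a n * b m * (1 / (of_nat (n * m) powr s)))" for s
    unfolding P Q sum_product by (intro sum.cong refl) (simp add: mult del: of_nat_mult)
  moreover have "(\<lambda>s. \<Sum>n=1..N. \<Sum>m=1..N'. a n * b m * (1 / (of_nat (n * m) powr s))) \<in> dirichlet_polynomials"
    by (intro dirichlet_sum dirichlet_term) (simp add: Suc_le_eq)
  ultimately show ?thesis
    by simp
qed

lemma dirichlet_const: "(\<lambda>_. c) \<in> dirichlet_polynomials"
  using dirichlet_term[of 1 c] by simp

lemma dirichlet_continuous_on:
  assumes "P \<in> dirichlet_polynomials"
  shows "continuous_on L P"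
proof -
  have "restrict P UNIV holomorphic_on UNIV"
    using restrict_dirichlet_polynomial_in_holomorphic_functions[OF assms, of UNIV]
    by (simp add: holomorphic_functions_def)
  then show ?thesis
    using continuous_on_subset by (fastforce dest: holomorphic_on_imp_continuous_on)
qed

section \<open>Approximation of the identity by Dirichlet polynomials\<close>

text \<open>The node $\log 1 = 0$ is treated by hand: $h(z) = (e^{-zs} - 1)/z$ satisfies $h(0) = -s$ and
$h(\log n) = (n^{-s} - 1)/\log n$ for $n \ge 2$. So interpolation of $h$ at $\log 2, \dots, \log N$,
evaluated at $0$, turns $-s$ into a Dirichlet polynomial.\<close>

lemma dirichlet_approximates_identity:
  assumes "\<epsilon> > 0"
  obtains P where "P \<in> dirichlet_polynomials" "\<And>s. norm s \<le> R \<Longrightarrow> norm (s - P s) < \<epsilon>"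
proof -
  \<comment> \<open>The $N$-th power of this quantity bounds the error: $e^{RN}$ bounds $g$ on the disc of radius $N$,
    $4/N$ is the gain per node, $\log N$ bounds the factors of the node polynomial.\<close>
  define q where "q = (\<lambda>N::nat. 4 * exp R * ln (real N) / real N)"
  have "(\<lambda>N. q N ^ N) \<longlonglongrightarrow> 0"
  proof -
    have "q \<longlonglongrightarrow> 0"
      unfolding q_def by real_asymp
    then have "eventually (\<lambda>N. q N < 1 / 2) sequentially"
      by (rule order_tendstoD) simp
    then have "eventually (\<lambda>N. norm (q N ^ N) \<le> (1 / 2) ^ N) sequentially"
      using eventually_ge_at_top[of 1]
      by eventually_elim (auto simp: q_def intro!: power_mono)
    moreover have "(\<lambda>N. (1 / 2 :: real) ^ N) \<longlonglongrightarrow> 0"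
      by (rule LIMSEQ_power_zero) simp
    ultimately show ?thesis
      by (rule Lim_null_comparison)
  qed
  then have "eventually (\<lambda>N. q N ^ N < \<epsilon>) sequentially"
    using \<open>\<epsilon> > 0\<close> by (rule order_tendstoD)
  moreover have "eventually (\<lambda>N. ln (real N) \<ge> 1) sequentially" "eventually (\<lambda>N. ln (real N) \<le> real N / 2) sequentially"
    by real_asymp+
  ultimately have "eventually (\<lambda>N. q N ^ N < \<epsilon> \<and> ln (real N) \<ge> 1 \<and> ln (real N) \<le> real N / 2 \<and> N \<ge> 1) sequentially"
    using eventually_ge_at_top[of 1] by eventually_elim auto
  then obtain N where N: "q N ^ N < \<epsilon>" "ln (real N) \<ge> 1" "ln (real N) \<le> real N / 2" "N \<ge> 1"
    using eventually_happens'[OF sequentially_bot] by blast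
  define x :: "nat \<Rightarrow> complex" where "x = (\<lambda>n. of_real (ln (real n)))"
  have norm_x: "norm (x n) \<le> ln N" "norm (x n) = ln n" "x n \<noteq> 0" if "n \<in> {2..N}" for n
    using that by (auto simp: x_def)
  have "inj_on x {2..N}"
    by (auto simp: inj_on_def x_def)
  moreover have "norm (x n) \<le> real N / 2" if "n \<in> {2..N}" for n
    using norm_x[OF that] N by linarith
  ultimately have "\<exists>c. \<forall>g M. g holomorphic_on UNIV \<longrightarrow> (\<forall>z. norm z \<le> real N \<longrightarrow> norm (g z) \<le> M) \<longrightarrow>
    norm (g 0 - (\<Sum>n=2..N. c n * g (x n))) \<le> M * (4 / N) ^ card {2..N} * (\<Prod>n=2..N. norm (0 - x n))"
    using N(4) by (intro interpolation_error) auto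
  then obtain c where c: "\<And>g M. g holomorphic_on UNIV \<Longrightarrow> (\<And>z. norm z \<le> real N \<Longrightarrow> norm (g z) \<le> M) \<Longrightarrow>
    norm (g 0 - (\<Sum>n=2..N. c n * g (x n))) \<le> M * (4 / N) ^ card {2..N} * (\<Prod>n=2..N. norm (0 - x n))"
    by blast
  define P where "P = (\<lambda>s. \<Sum>n=2..N. c n * (1 - 1 / (of_nat n powr s)) / x n)"
  show thesis
  proof
    have summand: "(\<lambda>s. c n / x n * (1 / (of_nat 1 powr s)) + (- c n / x n) * (1 / (of_nat n powr s))) \<in> dirichlet_polynomials"
      if "n \<in> {2..N}" for n
      by (intro dirichlet_add dirichlet_term) (use that in simp_all)
    have P_eq: "P = (\<lambda>s. \<Sum>n=2..N. c n / x n * (1 / (of_nat 1 powr s)) + (- c n / x n) * (1 / (of_nat n powr s)))"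
      unfolding P_def by (simp add: right_diff_distrib diff_divide_distrib mult.commute)
    show "P \<in> dirichlet_polynomials"
      unfolding P_eq by (rule dirichlet_sum) (rule summand)
    fix s :: complex assume s: "norm s \<le> R"
    define g where "g = (\<lambda>z. exp (- (z * s)))"
    have g: "g holomorphic_on UNIV"
      unfolding g_def by (intro holomorphic_on_exp' holomorphic_on_minus holomorphic_on_mult
        holomorphic_on_ident holomorphic_on_const)
    have bound: "norm (g z) \<le> exp R ^ N" if "norm z \<le> real N" for z
    proof -
      have "norm (g z) \<le> exp (norm (- (z * s)))"
        unfolding g_def by (rule norm_exp)
      also have "\<dots> \<le> exp (real N * R)"
        using that s by (auto simp: norm_mult intro!: mult_mono)
      finally show ?thesis
        by (simp add: exp_of_nat_mult)
    qed
    obtain h where h: "h holomorphic_on UNIV" "\<And>z. g z - g 0 = (z - 0) * h z" "h 0 = deriv g 0"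
      "\<And>z. norm z \<le> real N \<Longrightarrow> norm (h z) \<le> exp R ^ N * (4 / N)"
      using divided_difference[OF g, of 0 "real N"] bound N(4) by auto
    have "(g has_field_derivative (- s)) (at 0)"
      unfolding g_def by (auto intro!: derivative_eq_intros)
    then have h0: "h 0 = - s"
      using h(3) by (simp add: DERIV_imp_deriv)
    have hx: "h (x n) = - ((1 - 1 / (of_nat n powr s)) / x n)" if "n \<in> {2..N}" for n
    proof -
      have "g (x n) = 1 / (of_nat n powr s)"
        using that by (simp add: g_def x_def powr_def exp_minus divide_inverse mult.commute)
      then show ?thesis
        using h(2)[of "x n"] norm_x(3)[OF that] by (simp add: g_def field_simps)
    qed
    have "norm (s - P s) = norm (h 0 - (\<Sum>n=2..N. c n * h (x n)))"
    proof -
      have "(\<Sum>n=2..N. c n * h (x n)) = - P s"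
        unfolding P_def sum_negf[symmetric] by (intro sum.cong refl) (simp only: hx mult_minus_right times_divide_eq_right)
      then have "h 0 - (\<Sum>n=2..N. c n * h (x n)) = - (s - P s)"
        by (simp only: h0) simp
      then show ?thesis
        by (simp only: norm_minus_cancel)
    qed
    also have "\<dots> \<le> exp R ^ N * (4 / N) * (4 / N) ^ card {2..N} * (\<Prod>n=2..N. norm (0 - x n))"
      by (rule c[OF h(1,4)])
    also have "\<dots> \<le> exp R ^ N * (4 / N) * (4 / N) ^ card {2..N} * ln N ^ N"
    proof (rule mult_left_mono)
      have "(\<Prod>n=2..N. norm (0 - x n)) \<le> (\<Prod>n=2..N. ln N)"
        by (rule prod_mono) (use norm_x in auto)
      also have "\<dots> \<le> ln N ^ N"
        using N by (simp add: power_increasing)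
      finally show "(\<Prod>n=2..N. norm (0 - x n)) \<le> ln N ^ N" .
    qed simp
    also have "exp R ^ N * (4 / N) * (4 / N) ^ card {2..N} * ln N ^ N = q N ^ N"
    proof -
      have "(4 / real N) * (4 / real N) ^ card {2..N} = (4 / N) ^ N"
        using N(4) by (cases N) simp_all
      then have "exp R ^ N * (4 / N) * (4 / N) ^ card {2..N} * ln N ^ N = exp R ^ N * (4 / N) ^ N * ln N ^ N"
        by (simp only: mult.assoc)
      also have "\<dots> = (exp R * (4 / N) * ln N) ^ N"
        by (simp only: power_mult_distrib)
      also have "exp R * (4 / N) * ln N = q N"
        by (simp add: q_def)
      finally show ?thesis .
    qed
    also note N(1)
    finally show "norm (s - P s) < \<epsilon>" .
  qed
qed

section \<open>Uniformly closed algebras of functions on a compact set\<close>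

text \<open>Functions are total but only matter on $L$: uniform closure makes membership depend on
the values on $L$ alone.\<close>

locale uniformly_closed_algebra =
  fixes L :: "complex set" and B :: "(complex \<Rightarrow> complex) set"
  assumes compact: "compact L"
    and const: "\<And>c. (\<lambda>_. c) \<in> B"
    and add: "\<And>f g. f \<in> B \<Longrightarrow> g \<in> B \<Longrightarrow> (\<lambda>z. f z + g z) \<in> B"
    and mult: "\<And>f g. f \<in> B \<Longrightarrow> g \<in> B \<Longrightarrow> (\<lambda>z. f z * g z) \<in> B"
    and uniform_limit: "\<And>f. (\<And>\<epsilon>. \<epsilon> > 0 \<Longrightarrow> \<exists>g\<in>B. \<forall>z\<in>L. norm (f z - g z) \<le> \<epsilon>) \<Longrightarrow> f \<in> B"
begin

lemma cong:
  assumes "f \<in> B" "\<And>z. z \<in> L \<Longrightarrow> f z = g z"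
  shows "g \<in> B"
  using assms by (intro uniform_limit[of g]) (auto intro!: bexI[of _ f])

text \<open>The partial sums of the geometric series converge uniformly, at the rate $q^n/(1-q)$.\<close>

lemma inverse_one_minus:
  assumes u: "u \<in> B" and "q < 1" and q: "\<And>z. z \<in> L \<Longrightarrow> norm (u z) \<le> q"
  shows "(\<lambda>z. 1 / (1 - u z)) \<in> B"
proof (cases "L = {}")
  case True
  then show ?thesis
    using cong[OF const] by blast
next
  case False
  then have "q \<ge> 0"
    using q norm_ge_zero order_trans by blast
  have power: "(\<lambda>z. u z ^ n) \<in> B" for n
    by (induction n) (simp_all add: const mult u)
  have partial: "(\<lambda>z. \<Sum>i<n. u z ^ i) \<in> B" for n
    by (induction n) (simp_all add: const add power)
  show ?thesis
  proof (rule uniform_limit)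
    fix \<epsilon> :: real assume "\<epsilon> > 0"
    have "(\<lambda>n. q ^ n / (1 - q)) \<longlonglongrightarrow> 0 / (1 - q)"
      using \<open>q \<ge> 0\<close> \<open>q < 1\<close> by (intro tendsto_intros LIMSEQ_power_zero) auto
    then have "eventually (\<lambda>n. q ^ n / (1 - q) < \<epsilon>) sequentially"
      using \<open>\<epsilon> > 0\<close> by (auto dest: order_tendstoD(2))
    then obtain n where n: "q ^ n / (1 - q) < \<epsilon>"
      using eventually_happens'[OF sequentially_bot] by blast
    show "\<exists>g\<in>B. \<forall>z\<in>L. norm (1 / (1 - u z) - g z) \<le> \<epsilon>"
    proof (intro bexI[OF _ partial[of n]] ballI)
      fix z assume z: "z \<in> L"
      then have ne: "u z \<noteq> 1"
        using q[of z] \<open>q < 1\<close> by auto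
      have "norm (1 - u z) \<ge> 1 - q"
        using norm_triangle_ineq2[of 1 "u z"] q[OF z] by simp
      moreover have "1 / (1 - u z) - (\<Sum>i<n. u z ^ i) = u z ^ n / (1 - u z)"
        using ne by (simp add: sum_gp_strict field_simps)
      ultimately have "norm (1 / (1 - u z) - (\<Sum>i<n. u z ^ i)) \<le> q ^ n / (1 - q)"
        using q[OF z] \<open>q \<ge> 0\<close> \<open>q < 1\<close> by (auto simp: norm_divide norm_power intro!: frac_le power_mono)
      with n show "norm (1 / (1 - u z) - (\<Sum>i<n. u z ^ i)) \<le> \<epsilon>"
        by linarith
    qed
  qed
qed

text \<open>Since $1/(w'-z) = \frac{1}{w-z} \cdot \frac{1}{1-u}$ with $u = (w-w')/(w-z)$, the pole can be moved
from $w$ to $w'$ as long as the step is smaller than the distance from $w$ to $L$.\<close>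

lemma move_pole:
  assumes w: "(\<lambda>z. 1 / (w - z)) \<in> B" and "q < 1"
    and q: "\<And>z. z \<in> L \<Longrightarrow> w \<noteq> z \<and> norm (w - w') \<le> q * norm (w - z)"
  shows "(\<lambda>z. 1 / (w' - z)) \<in> B"
proof (rule cong)
  define u where "u = (\<lambda>z. (w - w') * (1 / (w - z)))"
  have u: "u \<in> B"
    unfolding u_def by (intro mult const w)
  have uq: "norm (u z) \<le> q" if "z \<in> L" for z
    using q[OF that] by (simp add: u_def norm_mult norm_divide pos_divide_le_eq)
  show "(\<lambda>z. 1 / (w - z) * (1 / (1 - u z))) \<in> B"
    by (intro mult w inverse_one_minus[OF u \<open>q < 1\<close> uq])
  fix z assume z: "z \<in> L"
  have "w - z \<noteq> 0"
    using q[OF z] by simp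
  then have "(w - z) * (1 - u z) = w' - z"
    by (simp add: u_def field_simps)
  then show "1 / (w - z) * (1 / (1 - u z)) = 1 / (w' - z)"
    by simp
qed

text \<open>Pole pushing. For a pole $v$ far away the function is $\frac1v \cdot \frac{1}{1 - z/v}$, a
geometric series in $z$; from there the pole travels through the connected complement of $L$ by
small steps.\<close>

lemma simple_pole:
  assumes id: "(\<lambda>z. z) \<in> B" and conn: "connected (- L)" and "w \<notin> L"
  shows "(\<lambda>z. 1 / (w - z)) \<in> B"
proof -
  obtain R where R: "R > 0" "\<And>z. z \<in> L \<Longrightarrow> norm z \<le> R"
    using compact_imp_bounded[OF compact] bounded_pos by blast
  define v :: complex where "v = of_real (2 * R)"
  have norm_v: "norm v = 2 * R"
    using R(1) by (simp add: v_def norm_mult)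
  have far: "(\<lambda>z. 1 / (v - z)) \<in> B"
  proof (rule cong)
    show "(\<lambda>z. (1 / v) * (1 / (1 - (1 / v) * z))) \<in> B"
    proof (rule mult[OF const inverse_one_minus[of _ "1 / 2"]])
      show "(\<lambda>z. (1 / v) * z) \<in> B"
        by (intro mult const id)
      show "norm ((1 / v) * z) \<le> 1 / 2" if "z \<in> L" for z
        using R(1) R(2)[OF that] by (simp add: norm_divide norm_v field_simps)
    qed simp
    have "v \<noteq> 0"
      using norm_v R(1) by auto
    then show "(1 / v) * (1 / (1 - (1 / v) * z)) = 1 / (v - z)" for z
      by (simp add: field_simps)
  qed
  have "v \<notin> L"
    using R norm_v by fastforce
  show ?thesis
  proof (rule connected_induction_simple[OF conn, of v w])
    show "(\<lambda>z. 1 / (v - z)) \<in> B" by (rule far)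
    fix a assume "a \<in> - L"
    moreover have "open (- L)"
      using compact by (simp add: compact_imp_closed open_Compl)
    ultimately obtain d where d: "d > 0" "ball a d \<subseteq> - L"
      by (meson openE)
    \<comment> \<open>If $B(a,d)$ misses $L$, then two points of $B(a,d/4)$ are less than $d/2$ apart and at distance at
      least $3d/4$ from $L$, which gives the ratio $2/3$ below.\<close>
    show "\<exists>T. openin (top_of_set (- L)) T \<and> a \<in> T \<and>
      (\<forall>x\<in>T. \<forall>y\<in>T. (\<lambda>z. 1 / (x - z)) \<in> B \<longrightarrow> (\<lambda>z. 1 / (y - z)) \<in> B)"
    proof (intro exI[of _ "ball a (d / 4)"] conjI ballI impI)
      show "openin (top_of_set (- L)) (ball a (d / 4))"
        using d by (intro open_subset) (auto simp: subset_iff)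
      show "a \<in> ball a (d / 4)"
        using d by simp
      fix x y assume x: "x \<in> ball a (d / 4)" and y: "y \<in> ball a (d / 4)"
        and px: "(\<lambda>z. 1 / (x - z)) \<in> B"
      show "(\<lambda>z. 1 / (y - z)) \<in> B"
      proof (rule move_pole[OF px, of "2 / 3"])
        fix z assume z: "z \<in> L"
        then have "dist a z \<ge> d"
          using d(2) by (meson ComplD linorder_not_less mem_ball subsetD)
        then have "dist x z \<ge> 3 / 4 * d"
          using x dist_triangle[of a z x] by simp
        moreover have "dist x y \<le> d / 2"
          using x y dist_triangle[of x y a] by (simp add: dist_commute)
        ultimately show "x \<noteq> z \<and> norm (x - y) \<le> 2 / 3 * norm (x - z)"
          using d(1) by (auto simp: dist_norm)
      qed simp
    qed
  qed (use \<open>w \<notin> L\<close> \<open>v \<notin> L\<close> in auto)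
qed

text \<open>An integral over a short interval is, uniformly in $z$, close to the length of the interval times
$h(x,z)$ for any $x$ in it. The error bound $\eta$ times length adds up over adjacent intervals, so
Bolzano's subdivision principle extends it to the whole interval.\<close>

lemma parametric_integral:
  fixes a b :: real
  assumes cont: "continuous_on ({a..b} \<times> L) (\<lambda>(t, z). h t z)" and "a \<le> b"
    and h: "\<And>t. t \<in> {a..b} \<Longrightarrow> h t \<in> B"
  shows "(\<lambda>z. integral {a..b} (\<lambda>t. h t z)) \<in> B"
proof (rule uniform_limit)
  fix \<epsilon> :: real assume "\<epsilon> > 0"
  define \<eta> where "\<eta> = \<epsilon> / (b - a + 1)"
  have \<eta>: "\<eta> > 0" "\<eta> * (b - a) \<le> \<epsilon>"
    using \<open>\<epsilon> > 0\<close> \<open>a \<le> b\<close> by (auto simp: \<eta>_def field_simps)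
  have "uniformly_continuous_on ({a..b} \<times> L) (\<lambda>(t, z). h t z)"
    using cont compact by (intro compact_uniformly_continuous compact_Times) auto
  then obtain d where d: "d > 0" and unif:
    "\<And>p q. p \<in> {a..b} \<times> L \<Longrightarrow> q \<in> {a..b} \<times> L \<Longrightarrow> dist q p < d \<Longrightarrow>
      dist ((\<lambda>(t, z). h t z) q) ((\<lambda>(t, z). h t z) p) < \<eta>"
    unfolding uniformly_continuous_on_def using \<eta>(1) by metis
  have cont_t: "continuous_on {c..e} (\<lambda>t. h t z)" if "z \<in> L" "a \<le> c" "e \<le> b" for c e z
  proof -
    have "continuous_on {c..e} ((\<lambda>(t, z). h t z) \<circ> (\<lambda>t. (t, z)))"
      using that by (intro continuous_on_compose continuous_intros continuous_on_subset[OF cont]) auto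
    then show ?thesis by (simp add: o_def)
  qed
  have "a \<le> a \<longrightarrow> b \<le> b \<longrightarrow> (\<exists>g\<in>B. \<forall>z\<in>L. norm (integral {a..b} (\<lambda>t. h t z) - g z) \<le> \<eta> * (b - a))"
    using \<open>a \<le> b\<close>
  proof (induction rule: Bolzano[where P = "\<lambda>c e. a \<le> c \<longrightarrow> e \<le> b \<longrightarrow>
      (\<exists>g\<in>B. \<forall>z\<in>L. norm (integral {c..e} (\<lambda>t. h t z) - g z) \<le> \<eta> * (e - c))"])
    case (trans c d e)
    show ?case
    proof (intro impI)
      assume bds: "a \<le> c" "e \<le> b"
      obtain g1 where g1: "g1 \<in> B" "\<And>z. z \<in> L \<Longrightarrow> norm (integral {c..d} (\<lambda>t. h t z) - g1 z) \<le> \<eta> * (d - c)"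
        using trans bds by force
      obtain g2 where g2: "g2 \<in> B" "\<And>z. z \<in> L \<Longrightarrow> norm (integral {d..e} (\<lambda>t. h t z) - g2 z) \<le> \<eta> * (e - d)"
        using trans bds by force
      show "\<exists>g\<in>B. \<forall>z\<in>L. norm (integral {c..e} (\<lambda>t. h t z) - g z) \<le> \<eta> * (e - c)"
      proof (intro bexI[OF _ add[OF g1(1) g2(1)]] ballI)
        fix z assume z: "z \<in> L"
        have "integral {c..e} (\<lambda>t. h t z) = integral {c..d} (\<lambda>t. h t z) + integral {d..e} (\<lambda>t. h t z)"
          using trans bds z by (intro Henstock_Kurzweil_Integration.integral_combine[symmetric] integrable_continuous_real cont_t) auto
        then have "norm (integral {c..e} (\<lambda>t. h t z) - (g1 z + g2 z)) \<le>
            norm (integral {c..d} (\<lambda>t. h t z) - g1 z) + norm (integral {d..e} (\<lambda>t. h t z) - g2 z)"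
          by (metis add_diff_add norm_triangle_ineq)
        also have "\<dots> \<le> \<eta> * (d - c) + \<eta> * (e - d)"
          by (intro add_mono g1 g2 z)
        finally show "norm (integral {c..e} (\<lambda>t. h t z) - (g1 z + g2 z)) \<le> \<eta> * (e - c)"
          by (simp add: algebra_simps)
      qed
    qed
  next
    case (local x)
    show ?case
    proof (intro exI[of _ d] conjI allI impI)
      fix c e assume *: "c \<le> x \<and> x \<le> e \<and> e - c < d" and bds: "a \<le> c" "e \<le> b"
      show "\<exists>g\<in>B. \<forall>z\<in>L. norm (integral {c..e} (\<lambda>t. h t z) - g z) \<le> \<eta> * (e - c)"
      proof (intro bexI[OF _ mult[OF const h]] ballI)
        show "x \<in> {a..b}" using local by simp
        fix z assume z: "z \<in> L"
        have "norm (integral {c..e} (\<lambda>t. h t z - h x z)) \<le> \<eta> * (e - c)"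
        proof (rule integral_bound)
          show "c \<le> e" using * by simp
          show "continuous_on {c..e} (\<lambda>t. h t z - h x z)"
            by (intro continuous_intros cont_t z bds)
          fix t assume t: "t \<in> {c..e}"
          have "dist (h t z) (h x z) < \<eta>"
            using unif[of "(x, z)" "(t, z)"] t * bds z by (auto simp: dist_Pair_Pair dist_real_def)
          then show "norm (h t z - h x z) \<le> \<eta>"
            by (simp add: dist_norm)
        qed
        also have "integral {c..e} (\<lambda>t. h t z - h x z) = integral {c..e} (\<lambda>t. h t z) - of_real (e - c) * h x z"
          using * bds z by (subst Henstock_Kurzweil_Integration.integral_diff)
            (auto intro!: integrable_continuous_real cont_t simp: scaleR_conv_of_real)
        finally show "norm (integral {c..e} (\<lambda>t. h t z) - of_real (e - c) * h x z) \<le> \<eta> * (e - c)" .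
      qed
    qed (rule d)
  qed
  then show "\<exists>g\<in>B. \<forall>z\<in>L. norm (integral {a..b} (\<lambda>t. h t z) - g z) \<le> \<epsilon>"
    using \<eta>(2) by (meson order.refl order_trans)
qed

text \<open>Runge's theorem for $L = \phi(\overline{B}(0,r))$. For $z = \phi(\xi)$ in $L$ and $r < \rho < 1$,
Cauchy's formula becomes, after the substitution $w = \phi(\zeta)$,
$$f(z) = \frac{1}{2\pi i} \oint_{|\zeta| = \rho} \frac{f(\phi(\zeta))\,\phi'(\zeta)}{\phi(\zeta) - z}\,d\zeta.$$
This is the ordinary formula at $\xi$ for the function $(f \circ \phi)\,\phi'/Q$ on the circle, where
$Q(\zeta) = (\phi(\zeta) - \phi(\xi))/(\zeta - \xi)$, extended by $\phi'(\xi)$, has no zeros because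
$\phi$ is injective. As a function of $z$, the integrand is a multiple of $1/(w-z)$ with $w$ outside $L$.\<close>

lemma holomorphic_on_disc_image:
  assumes id: "(\<lambda>z. z) \<in> B"
    and \<phi>: "\<phi> holomorphic_on ball 0 1" "inj_on \<phi> (ball 0 1)"
    and r: "r < 1" "L = \<phi> ` cball 0 r"
    and f: "f holomorphic_on \<phi> ` ball 0 1"
  shows "f \<in> B"
proof (cases "r < 0")
  case True
  then show ?thesis
    using r by (intro cong[OF const]) auto
next
  case False
  obtain \<rho> where \<rho>: "r < \<rho>" "\<rho> < 1"
    using dense r(1) by blast
  have "\<rho> > 0" using False \<rho> by simp
  have sub: "cball 0 r \<subseteq> ball (0::complex) 1" "cball 0 \<rho> \<subseteq> ball (0::complex) 1"
    using r \<rho> by auto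
  have cont_\<phi>: "continuous_on (ball 0 1) \<phi>"
    using \<phi>(1) by (rule holomorphic_on_imp_continuous_on)
  have "cball (0::complex) r homeomorphic L"
    by (rule homeomorphic_compact[OF compact_cball continuous_on_subset[OF cont_\<phi> sub(1)]
      r(2)[symmetric] inj_on_subset[OF \<phi>(2) sub(1)]])
  then have "L homeomorphic cball (0::complex) r"
    by (rule homeomorphic_sym[THEN iffD1])
  then have conn: "connected (- L)"
    by (rule connected_complement_homeomorphic_convex_compact) auto
  define \<gamma> where "\<gamma> = circlepath 0 \<rho>"
  define F where "F = (\<lambda>\<zeta>. f (\<phi> \<zeta>) * deriv \<phi> \<zeta>)"
  have F: "F holomorphic_on ball 0 1"
    unfolding F_def
    by (intro holomorphic_on_mult holomorphic_on_compose[OF \<phi>(1) f, unfolded o_def]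
      holomorphic_deriv \<phi>(1) open_ball)
  have \<gamma>: "norm (\<gamma> t) = \<rho>" for t
    using \<open>\<rho> > 0\<close> by (simp add: \<gamma>_def circlepath norm_mult)
  have \<gamma>_ball: "\<gamma> t \<in> ball 0 1" for t
    using \<gamma> \<rho> by simp
  have off: "\<phi> (\<gamma> t) \<notin> L" for t
  proof
    assume "\<phi> (\<gamma> t) \<in> L"
    then obtain \<zeta> where "\<zeta> \<in> cball 0 r" "\<phi> (\<gamma> t) = \<phi> \<zeta>"
      unfolding r(2) by blast
    then have "\<gamma> t = \<zeta>" "norm \<zeta> \<le> r"
      using \<phi>(2) \<gamma>_ball[of t] sub(1) by (auto simp: inj_on_def)
    then show False
      using \<gamma>[of t] \<rho>(1) by simp
  qed
  define k where "k = (\<lambda>t. 1 / (2 * of_real pi * \<i>) * (F (\<gamma> t) * vector_derivative \<gamma> (at t)))"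
  define h where "h = (\<lambda>t z. k t * (1 / (\<phi> (\<gamma> t) - z)))"
  have cont_\<gamma>: "continuous_on A \<gamma>" for A
    unfolding \<gamma>_def circlepath by (intro continuous_intros)
  have cont_comp: "continuous_on {0..1} (\<lambda>t. G (\<gamma> t))" if "continuous_on (ball 0 1) G" for G :: "complex \<Rightarrow> complex"
    using that \<gamma>_ball by (intro continuous_on_compose2[OF that cont_\<gamma>]) auto
  have cont_k: "continuous_on {0..1} k"
    unfolding k_def
    by (intro continuous_intros cont_comp holomorphic_on_imp_continuous_on F)
      (auto simp: \<gamma>_def vector_derivative_circlepath intro!: continuous_intros)
  have "(\<lambda>z. integral {0..1} (\<lambda>t. h t z)) \<in> B"
  proof (rule parametric_integral)
    show "h t \<in> B" for t
      unfolding h_def by (intro mult const simple_pole id conn off)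
    have "continuous_on ({0..1} \<times> L) (\<lambda>p. k (fst p) * (1 / (\<phi> (\<gamma> (fst p)) - snd p)))"
    proof (intro continuous_intros ballI)
      show "continuous_on ({0..1} \<times> L) (\<lambda>p. k (fst p))"
        by (rule continuous_on_compose2[OF cont_k continuous_on_fst[OF continuous_on_id]]) auto
      show "continuous_on ({0..1} \<times> L) (\<lambda>p. \<phi> (\<gamma> (fst p)))"
        by (rule continuous_on_compose2[OF cont_comp[OF cont_\<phi>] continuous_on_fst[OF continuous_on_id]]) auto
      show "\<phi> (\<gamma> (fst p)) - snd p \<noteq> 0" if "p \<in> {0..1} \<times> L" for p
        using off[of "fst p"] that by auto
    qed
    then show "continuous_on ({0..1} \<times> L) (\<lambda>(t, z). h t z)"
      by (simp add: h_def case_prod_beta)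
  qed simp
  then show ?thesis
  proof (rule cong)
    fix z assume "z \<in> L"
    then obtain \<xi> where \<xi>: "norm \<xi> \<le> r" "z = \<phi> \<xi>"
      unfolding r(2) by auto
    have \<xi>_ball: "\<xi> \<in> ball 0 1"
      using \<xi> r by simp
    define Q where "Q = (\<lambda>\<zeta>. if \<zeta> = \<xi> then deriv \<phi> \<xi> else (\<phi> \<zeta> - \<phi> \<xi>) / (\<zeta> - \<xi>))"
    have Q: "Q holomorphic_on ball 0 1"
      unfolding Q_def using \<phi>(1) by (rule pole_lemma_open) simp
    have Q0: "Q \<zeta> \<noteq> 0" if "\<zeta> \<in> ball 0 1" for \<zeta>
    proof (cases "\<zeta> = \<xi>")
      case True
      then show ?thesis
        using holomorphic_injective_imp_regular[OF \<phi>(1) open_ball \<phi>(2) \<xi>_ball] by (simp add: Q_def)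
    next
      case False
      then show ?thesis
        using \<phi>(2) \<xi>_ball that unfolding Q_def by (auto simp: inj_on_def)
    qed
    have "(\<lambda>\<zeta>. F \<zeta> / Q \<zeta>) holomorphic_on ball 0 1"
      using Q0 by (intro holomorphic_intros F Q) auto
    then have "(\<lambda>\<zeta>. F \<zeta> / Q \<zeta>) holomorphic_on cball 0 \<rho>"
      using sub(2) by (rule holomorphic_on_subset)
    then have "((\<lambda>\<zeta>. F \<zeta> / Q \<zeta> / (\<zeta> - \<xi>)) has_contour_integral (2 * of_real pi * \<i> * (F \<xi> / Q \<xi>))) \<gamma>"
      unfolding \<gamma>_def by (rule Cauchy_integral_circlepath_simple) (use \<xi> \<rho> in simp)
    moreover have "F \<xi> / Q \<xi> = f z"
      using Q0[OF \<xi>_ball] \<xi> by (simp add: F_def Q_def)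
    ultimately have "((\<lambda>t. F (\<gamma> t) / Q (\<gamma> t) / (\<gamma> t - \<xi>) * vector_derivative \<gamma> (at t)) has_integral
        (2 * of_real pi * \<i> * f z)) {0..1}"
      by (simp add: has_contour_integral)
    then have "((\<lambda>t. 1 / (2 * of_real pi * \<i>) * (F (\<gamma> t) / Q (\<gamma> t) / (\<gamma> t - \<xi>) * vector_derivative \<gamma> (at t))) has_integral
        1 / (2 * of_real pi * \<i>) * (2 * of_real pi * \<i> * f z)) {0..1}"
      by (rule has_integral_mult_right)
    moreover have "1 / (2 * of_real pi * \<i>) * (F (\<gamma> t) / Q (\<gamma> t) / (\<gamma> t - \<xi>) * vector_derivative \<gamma> (at t)) = h t z" for t
    proof -
      have "\<gamma> t \<noteq> \<xi>"
        using \<gamma>[of t] \<xi> \<rho> by auto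
      then show ?thesis
        by (simp add: h_def k_def Q_def \<xi>(2))
    qed
    ultimately show "integral {0..1} (\<lambda>t. h t z) = f z"
      by (simp add: integral_unique)
  qed
qed

end

definition uniform_closure_on :: "complex set \<Rightarrow> (complex \<Rightarrow> complex) set \<Rightarrow> (complex \<Rightarrow> complex) set" where
  "uniform_closure_on L A = {f. \<forall>\<epsilon>>0. \<exists>P\<in>A. \<forall>z\<in>L. norm (f z - P z) < \<epsilon>}"

lemma uniform_closure_onD:
  assumes "f \<in> uniform_closure_on L A" and "\<epsilon> > 0"
  obtains P where "P \<in> A" "\<And>z. z \<in> L \<Longrightarrow> norm (f z - P z) < \<epsilon>"
  using assms unfolding uniform_closure_on_def by blast

lemma uniform_closure_on_bounded:
  assumes "compact L" and "\<And>P. P \<in> A \<Longrightarrow> continuous_on L P" and "f \<in> uniform_closure_on L A"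
  obtains b where "b > 0" "\<And>z. z \<in> L \<Longrightarrow> norm (f z) \<le> b"
proof -
  obtain P where P: "P \<in> A" "\<And>z. z \<in> L \<Longrightarrow> norm (f z - P z) < 1"
    using uniform_closure_onD[OF assms(3) zero_less_one] by blast
  have "bounded (P ` L)"
    using assms(1,2) P(1) by (intro compact_imp_bounded compact_continuous_image)
  then obtain c where c: "c > 0" "\<And>z. z \<in> L \<Longrightarrow> norm (P z) \<le> c"
    unfolding bounded_pos by blast
  show thesis
  proof (rule that[of "c + 1"])
    show "norm (f z) \<le> c + 1" if "z \<in> L" for z
      using norm_triangle_sub[of "f z" "P z"] c(2)[OF that] P(2)[OF that] by linarith
  qed (use c in simp)
qed

text \<open>For products, $fg - PQ = (f - P) g + P (g - Q)$. First $P$ is chosen, with an accuracy that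
depends on a bound for $g$, and then $Q$, with an accuracy that depends on a bound for $P$.\<close>

lemma uniformly_closed_algebra_uniform_closure_on:
  assumes "compact L" and cont: "\<And>P. P \<in> A \<Longrightarrow> continuous_on L P"
    and const: "\<And>c. (\<lambda>_. c) \<in> A"
    and add: "\<And>P Q. P \<in> A \<Longrightarrow> Q \<in> A \<Longrightarrow> (\<lambda>z. P z + Q z) \<in> A"
    and mult: "\<And>P Q. P \<in> A \<Longrightarrow> Q \<in> A \<Longrightarrow> (\<lambda>z. P z * Q z) \<in> A"
  shows "uniformly_closed_algebra L (uniform_closure_on L A)"
proof
  show "compact L" by (rule assms(1))
next
  fix c :: complex
  show "(\<lambda>_. c) \<in> uniform_closure_on L A"
    unfolding uniform_closure_on_def using const by (intro CollectI allI impI bexI[of _ "\<lambda>_. c"]) simp_all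
next
  fix f g assume fg: "f \<in> uniform_closure_on L A" "g \<in> uniform_closure_on L A"
  show "(\<lambda>z. f z + g z) \<in> uniform_closure_on L A"
    unfolding uniform_closure_on_def
  proof (intro CollectI allI impI)
    fix \<epsilon> :: real assume "\<epsilon> > 0"
    obtain P where P: "P \<in> A" "\<And>z. z \<in> L \<Longrightarrow> norm (f z - P z) < \<epsilon> / 2"
      using uniform_closure_onD[OF fg(1) half_gt_zero[OF \<open>\<epsilon> > 0\<close>]] by blast
    obtain Q where Q: "Q \<in> A" "\<And>z. z \<in> L \<Longrightarrow> norm (g z - Q z) < \<epsilon> / 2"
      using uniform_closure_onD[OF fg(2) half_gt_zero[OF \<open>\<epsilon> > 0\<close>]] by blast
    show "\<exists>P\<in>A. \<forall>z\<in>L. norm (f z + g z - P z) < \<epsilon>"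
    proof (intro bexI[OF _ add[OF P(1) Q(1)]] ballI)
      fix z assume "z \<in> L"
      then show "norm (f z + g z - (P z + Q z)) < \<epsilon>"
        using P(2)[of z] Q(2)[of z] norm_diff_triangle_ineq[of "f z" "g z" "P z" "Q z"] by simp
    qed
  qed
  show "(\<lambda>z. f z * g z) \<in> uniform_closure_on L A"
    unfolding uniform_closure_on_def
  proof (intro CollectI allI impI)
    fix \<epsilon> :: real assume "\<epsilon> > 0"
    obtain b where b: "b > 0" "\<And>z. z \<in> L \<Longrightarrow> norm (g z) \<le> b"
      using uniform_closure_on_bounded[OF \<open>compact L\<close> cont fg(2)] by blast
    obtain P where P: "P \<in> A" "\<And>z. z \<in> L \<Longrightarrow> norm (f z - P z) < \<epsilon> / 2 / b"
      using uniform_closure_onD[OF fg(1) divide_pos_pos[OF half_gt_zero[OF \<open>\<epsilon> > 0\<close>] b(1)]] by blast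
    have "bounded (P ` L)"
      using \<open>compact L\<close> cont P(1) by (intro compact_imp_bounded compact_continuous_image)
    then obtain c where c: "c > 0" "\<And>z. z \<in> L \<Longrightarrow> norm (P z) \<le> c"
      unfolding bounded_pos by blast
    obtain Q where Q: "Q \<in> A" "\<And>z. z \<in> L \<Longrightarrow> norm (g z - Q z) < \<epsilon> / 2 / c"
      using uniform_closure_onD[OF fg(2) divide_pos_pos[OF half_gt_zero[OF \<open>\<epsilon> > 0\<close>] c(1)]] by blast
    show "\<exists>P\<in>A. \<forall>z\<in>L. norm (f z * g z - P z) < \<epsilon>"
    proof (intro bexI[OF _ mult[OF P(1) Q(1)]] ballI)
      fix z assume z: "z \<in> L"
      have "f z * g z - P z * Q z = (f z - P z) * g z + P z * (g z - Q z)"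
        by (simp add: algebra_simps)
      then have "norm (f z * g z - P z * Q z) \<le> norm (f z - P z) * norm (g z) + norm (P z) * norm (g z - Q z)"
        by (metis norm_mult norm_triangle_ineq)
      also have "\<dots> \<le> norm (f z - P z) * b + c * norm (g z - Q z)"
        using b(2)[OF z] c(2)[OF z] c(1) by (intro add_mono mult_mono) auto
      also have "\<dots> < \<epsilon> / 2 + \<epsilon> / 2"
        using P(2)[OF z] Q(2)[OF z] b(1) c(1)
        by (intro add_strict_mono) (simp_all only: pos_less_divide_eq mult.commute[of c])
      finally show "norm (f z * g z - P z * Q z) < \<epsilon>" by simp
    qed
  qed
next
  fix f assume lim: "\<And>\<epsilon>. \<epsilon> > 0 \<Longrightarrow> \<exists>g\<in>uniform_closure_on L A. \<forall>z\<in>L. norm (f z - g z) \<le> \<epsilon>"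
  show "f \<in> uniform_closure_on L A"
    unfolding uniform_closure_on_def
  proof (intro CollectI allI impI)
    fix \<epsilon> :: real assume "\<epsilon> > 0"
    then obtain g where g: "g \<in> uniform_closure_on L A" "\<And>z. z \<in> L \<Longrightarrow> norm (f z - g z) \<le> \<epsilon> / 2"
      using lim[of "\<epsilon> / 2"] by auto
    obtain P where P: "P \<in> A" "\<And>z. z \<in> L \<Longrightarrow> norm (g z - P z) < \<epsilon> / 2"
      using uniform_closure_onD[OF g(1) half_gt_zero[OF \<open>\<epsilon> > 0\<close>]] by blast
    show "\<exists>P\<in>A. \<forall>z\<in>L. norm (f z - P z) < \<epsilon>"
    proof (intro bexI[OF _ P(1)] ballI)
      fix z assume z: "z \<in> L"
      show "norm (f z - P z) < \<epsilon>"
        using norm_triangle_ineq[of "f z - g z" "g z - P z"] g(2)[OF z] P(2)[OF z] by simp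
    qed
  qed
qed

section \<open>Compact subsets of simply connected sets\<close>

text \<open>For \<open>\<Omega> \<noteq> UNIV\<close> this is the Riemann mapping theorem. The plane has no Riemann map, but there a large
round disc serves, so $\phi$ is only required to map into \<open>\<Omega>\<close>, not onto it.\<close>

lemma disc_neighbourhood:
  fixes \<Omega> K :: "complex set"
  assumes "open \<Omega>" "simply_connected \<Omega>" "\<Omega> \<noteq> {}" "compact K" "K \<subseteq> \<Omega>"
  obtains \<phi> r where "\<phi> holomorphic_on ball 0 1" "inj_on \<phi> (ball 0 1)" "\<phi> ` ball 0 1 \<subseteq> \<Omega>"
    "r < 1" "K \<subseteq> \<phi> ` cball 0 r"
proof (cases "\<Omega> = UNIV")
  case True
  obtain R where R: "R > 0" "\<And>z. z \<in> K \<Longrightarrow> norm z \<le> R"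
    using compact_imp_bounded[OF \<open>compact K\<close>] bounded_pos by blast
  show thesis
  proof (rule that[of "\<lambda>z. of_real (2 * R) * z" "1 / 2"])
    show "(\<lambda>z. of_real (2 * R) * z) holomorphic_on ball 0 1"
      by (intro holomorphic_intros)
    show "inj_on (\<lambda>z. complex_of_real (2 * R) * z) (ball 0 1)"
      using R(1) by (auto simp: inj_on_def)
    show "K \<subseteq> (\<lambda>z. of_real (2 * R) * z) ` cball 0 (1 / 2)"
    proof
      fix z assume "z \<in> K"
      then show "z \<in> (\<lambda>z. of_real (2 * R) * z) ` cball 0 (1 / 2)"
        using R by (intro image_eqI[of _ _ "z / of_real (2 * R)"]) (auto simp: norm_divide norm_mult)
    qed
  qed (use True in auto)
next
  case False
  then obtain \<psi> \<phi> where \<psi>: "\<psi> holomorphic_on \<Omega>" and \<phi>: "\<phi> holomorphic_on ball 0 1"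
    and \<psi>\<phi>: "\<And>z. z \<in> \<Omega> \<Longrightarrow> \<psi> z \<in> ball 0 1 \<and> \<phi> (\<psi> z) = z"
    and \<phi>\<psi>: "\<And>z. z \<in> ball 0 1 \<Longrightarrow> \<phi> z \<in> \<Omega> \<and> \<psi> (\<phi> z) = z"
    using simply_connected_eq_biholomorphic_to_disc[OF \<open>open \<Omega>\<close>] assms(2,3) by blast
  have compact: "compact (\<psi> ` K)"
    using \<psi> assms(4,5) by (intro compact_continuous_image)
      (auto intro: holomorphic_on_imp_continuous_on continuous_on_subset)
  have sub: "\<psi> ` K \<subseteq> ball 0 1"
    using \<psi>\<phi> assms(5) by blast
  obtain r where r: "r < 1" "\<psi> ` K \<subseteq> cball 0 r"
  proof (cases "K = {}")
    case True
    then show thesis using that[of 0] by simp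
  next
    case False
    then obtain w where w: "w \<in> \<psi> ` K" "\<And>v. v \<in> \<psi> ` K \<Longrightarrow> norm v \<le> norm w"
      using continuous_attains_sup[OF compact, of norm] continuous_on_norm_id by blast
    then show thesis
      using sub that[of "norm w"] by (auto simp: subset_iff)
  qed
  show thesis
  proof (rule that[OF \<phi> _ _ r(1)])
    show "inj_on \<phi> (ball 0 1)"
      using \<phi>\<psi> by (metis inj_onI)
    show "\<phi> ` ball 0 1 \<subseteq> \<Omega>"
      using \<phi>\<psi> by blast
    show "K \<subseteq> \<phi> ` cball 0 r"
    proof
      fix z assume "z \<in> K"
      then have "\<psi> z \<in> cball 0 r" "\<phi> (\<psi> z) = z"
        using r(2) \<psi>\<phi> assms(5) by blast+
      then show "z \<in> \<phi> ` cball 0 r"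
        by (metis imageI)
    qed
  qed
qed

section \<open>Density of Dirichlet polynomials\<close>

text \<open>With the algebra structure, this puts all polynomials into the closure.\<close>

lemma dirichlet_closure_contains_identity:
  assumes "compact L"
  shows "(\<lambda>z. z) \<in> uniform_closure_on L dirichlet_polynomials"
proof -
  obtain R where R: "\<And>z. z \<in> L \<Longrightarrow> norm z \<le> R"
    using compact_imp_bounded[OF assms] bounded_iff by blast
  show ?thesis
    unfolding uniform_closure_on_def
  proof (intro CollectI allI impI)
    fix \<epsilon> :: real assume "\<epsilon> > 0"
    then obtain P where "P \<in> dirichlet_polynomials" "\<And>s. norm s \<le> R \<Longrightarrow> norm (s - P s) < \<epsilon>"
      using dirichlet_approximates_identity by blast
    then show "\<exists>P\<in>dirichlet_polynomials. \<forall>z\<in>L. norm (z - P z) < \<epsilon>"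
      using R by blast
  qed
qed

lemma dirichlet_approximation:
  assumes "open \<Omega>" "simply_connected \<Omega>" "f holomorphic_on \<Omega>" "compact K" "K \<subseteq> \<Omega>" "\<epsilon> > 0"
  obtains P where "P \<in> dirichlet_polynomials" "\<And>z. z \<in> K \<Longrightarrow> norm (f z - P z) < \<epsilon>"
proof (cases "\<Omega> = {}")
  case True
  then show thesis
    using that[OF dirichlet_const] assms(5) by auto
next
  case False
  obtain \<phi> r where \<phi>: "\<phi> holomorphic_on ball 0 1" "inj_on \<phi> (ball 0 1)" "\<phi> ` ball 0 1 \<subseteq> \<Omega>"
    and r: "r < 1" "K \<subseteq> \<phi> ` cball 0 r"
    using disc_neighbourhood[OF assms(1,2) False assms(4,5)] by blast
  \<comment> \<open>$K$ itself may have a disconnected complement; $L$ fills it in without leaving \<open>\<Omega>\<close>.\<close>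
  define L where "L = \<phi> ` cball 0 r"
  have "cball 0 r \<subseteq> ball (0::complex) 1"
    using r(1) by auto
  then have "compact L"
    unfolding L_def
    by (intro compact_continuous_image compact_cball
      continuous_on_subset[OF holomorphic_on_imp_continuous_on[OF \<phi>(1)]])
  then interpret uniformly_closed_algebra L "uniform_closure_on L dirichlet_polynomials"
    by (intro uniformly_closed_algebra_uniform_closure_on dirichlet_continuous_on
      dirichlet_const dirichlet_add dirichlet_mult)
  have "f \<in> uniform_closure_on L dirichlet_polynomials"
    using dirichlet_closure_contains_identity[OF \<open>compact L\<close>] \<phi>(1,2) r(1) L_def
      holomorphic_on_subset[OF assms(3) \<phi>(3)] by (rule holomorphic_on_disc_image)
  then obtain P where "P \<in> dirichlet_polynomials" "\<forall>z\<in>L. norm (f z - P z) < \<epsilon>"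
    unfolding uniform_closure_on_def using \<open>\<epsilon> > 0\<close> by blast
  then show thesis
    using that r(2) L_def by blast
qed

theorem theorem4p2:
  fixes \<Omega> :: "complex set"
  assumes "open \<Omega>" and "simply_connected \<Omega>"
  shows "holomorphic_topology \<Omega> closure_of ((\<lambda>P. restrict P \<Omega>) ` dirichlet_polynomials) =
         topspace (holomorphic_topology \<Omega>)"
proof
  show "holomorphic_topology \<Omega> closure_of ((\<lambda>P. restrict P \<Omega>) ` dirichlet_polynomials) \<subseteq>
      topspace (holomorphic_topology \<Omega>)"
    by (rule closure_of_subset_topspace)
  show "topspace (holomorphic_topology \<Omega>) \<subseteq>
      holomorphic_topology \<Omega> closure_of ((\<lambda>P. restrict P \<Omega>) ` dirichlet_polynomials)"
  proof
    fix f assume f: "f \<in> topspace (holomorphic_topology \<Omega>)"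
    show "f \<in> holomorphic_topology \<Omega> closure_of ((\<lambda>P. restrict P \<Omega>) ` dirichlet_polynomials)"
      unfolding in_closure_of
    proof (intro conjI f allI impI)
      fix U assume "f \<in> U \<and> openin (holomorphic_topology \<Omega>) U"
      then obtain K \<epsilon> where K: "compact K" "K \<subseteq> \<Omega>" "\<epsilon> > 0"
        and U: "{g \<in> holomorphic_functions \<Omega>. \<forall>z\<in>K. dist (f z) (g z) < \<epsilon>} \<subseteq> U"
        unfolding openin_holomorphic_topology by blast
      have "f holomorphic_on \<Omega>"
        using f by (simp add: holomorphic_functions_def)
      then obtain P where P: "P \<in> dirichlet_polynomials" "\<And>z. z \<in> K \<Longrightarrow> norm (f z - P z) < \<epsilon>"
        using dirichlet_approximation[OF assms _ K] by blast
      have "restrict P \<Omega> \<in> U"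
        using U restrict_dirichlet_polynomial_in_holomorphic_functions[OF P(1), of \<Omega>] P(2) K(2)
        by (auto simp: dist_norm subset_iff)
      then show "\<exists>y. y \<in> (\<lambda>P. restrict P \<Omega>) ` dirichlet_polynomials \<and> y \<in> U"
        using P(1) by blast
    qed
  qed
qed

end
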